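(* Let $\alpha>0$ and let $H_1,H_2,\ldots$ be i.i.d. real random variables whose common law has regularly varying tails with tail exponent $\alpha$. For each $n$ let $X_1,\ldots,X_n$ be the associated sample with truncated power tails, with truncation level $M_n>0$ and auxiliary variables $R_j$ (see context). Let $\alpha<A<\infty$ and put $$Z_n(A)=\frac{\sum_{i=1}^n|X_i|^A}{\max_{1\le i\le n}|X_i|^A}.$$ Let $\epsilon\in(0,1)$. Assume that $ER_1^{2A}<\infty$ and that $\lim_{n\to\infty}n^{1-\epsilon}P(|H_1|>M_n)=\infty$ (strengthened hypothesis of hard truncation). Then $$\liminf_{n\to\infty}P\bigl(n^{-\epsilon/2}Z_n(A)>x\bigr)\ge e^{-x^2}\quad\text{for every }x>0 .$$
   Context: Regularly varying tails (on $\mathbb{R}$): there exist a sequence $a_n\uparrow\infty$ and a non-null Radon measure $\mu$ on $[-\infty,\infty]\setminus\{0\}$ with $\mu(\{-\infty,\infty\})=0$ such that $nP(a_n^{-1}H_1\in\cdot)\to\mu(\cdot)$ vaguely on $[-\infty,\infty]\setminus\{0\}$, where $\mu(cB)=c^{-\alpha}\mu(B)$ for all $c>0$ and Borel $B$; $\alpha$ is the tail exponent. Truncated model: $R_1,R_2,\ldots$ are i.i.d. nonnegative random variables independent of $(H_j)$, $M_n>0$ is deterministic, and for each $n$ the sample is $X_j=X_{nj}$, $j=1,\ldots,n$, where $$X_{nj}=H_j\mathbf 1(|H_j|\le M_n)+\frac{H_j}{|H_j|}(M_n+R_j)\mathbf 1(|H_j|>M_n).$$ $Z_n(A)$ is defined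 arbitrarily when its denominator is $0$. *)

theory Defs
  imports "HOL-Probability.Probability"
begin

definition punctured_ereal :: "ereal set" where
  "punctured_ereal = UNIV - {0}"

text \<open>The punctured extended line is locally compact with a countable base, so its Radon
  measures are exactly the Borel measures that are finite on compact sets (regularity is
  automatic). Compact sets of the subspace are bounded away from 0 but may contain the
  two infinite points.\<close>

definition radon_measure_punctured :: "ereal measure \<Rightarrow> bool" where
  "radon_measure_punctured \<mu> \<longleftrightarrow>
     sets \<mu> = sets (restrict_space borel punctured_ereal) \<and>
     (\<forall>K. compact K \<and> K \<subseteq> punctured_ereal \<longrightarrow> emeasure \<mu> K < \<infinity>)"

definition vague_conv_punctured :: "(nat \<Rightarrow> ereal measure) \<Rightarrow> ereal measure \<Rightarrow> bool" where
  "vague_conv_punctured \<nu> \<mu> \<longleftrightarrow>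
     (\<forall>f :: ereal \<Rightarrow> real.
        continuous_on punctured_ereal f \<and>
        (\<exists>K. compact K \<and> K \<subseteq> punctured_ereal \<and> (\<forall>x\<in>punctured_ereal - K. f x = 0)) \<longrightarrow>
        (\<lambda>n. \<integral>x. f x \<partial>\<nu> n) \<longlonglongrightarrow> (\<integral>x. f x \<partial>\<mu>))"

text \<open>The measure \<open>n P(H / a \<in> \<cdot>)\<close> on the punctured extended line, where \<open>\<nu>\<close> is the law of
  the real random variable \<open>H\<close>.\<close>

definition rescaled_law :: "real measure \<Rightarrow> nat \<Rightarrow> real \<Rightarrow> ereal measure" where
  "rescaled_law \<nu> n a =
     scale_measure (of_nat n)
       (restrict_space (distr \<nu> borel (\<lambda>h. ereal (inverse a * h))) punctured_ereal)"

text \<open>Since \<open>a\<close> increases to infinity, \<open>a n > 0\<close> for all but finitely many \<open>n\<close>, and the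
  remaining terms do not affect the limit.\<close>

definition regularly_varying_tails :: "real measure \<Rightarrow> real \<Rightarrow> bool" where
  "regularly_varying_tails \<nu> \<alpha> \<longleftrightarrow>
     (\<exists>(a :: nat \<Rightarrow> real) \<mu>.
        incseq a \<and> filterlim a at_top sequentially \<and>
        radon_measure_punctured \<mu> \<and>
        emeasure \<mu> (space \<mu>) \<noteq> 0 \<and>
        emeasure \<mu> {-\<infinity>, \<infinity>} = 0 \<and>
        vague_conv_punctured (\<lambda>n. rescaled_law \<nu> n (a n)) \<mu> \<and>
        (\<forall>c>0. \<forall>B\<in>sets \<mu>.
           emeasure \<mu> ((\<lambda>x. ereal c * x) ` B) = ennreal (c powr (- \<alpha>)) * emeasure \<mu> B))"

text \<open>Truncation of \<open>h\<close> at level \<open>m\<close> with auxiliary value \<open>r\<close>; for \<open>h = 0\<close> and \<open>m > 0\<close> only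
  the first summand matters.\<close>

definition truncate_tail :: "real \<Rightarrow> real \<Rightarrow> real \<Rightarrow> real" where
  "truncate_tail m h r =
     h * of_bool (\<bar>h\<bar> \<le> m) + h / \<bar>h\<bar> * (m + r) * of_bool (\<bar>h\<bar> > m)"

text \<open>The statistic \<open>Z\<^sub>n(A)\<close> of a sample \<open>x 1, \<dots>, x n\<close> with \<open>n \<ge> 1\<close>; \<open>d\<close> is the value
  chosen when the denominator vanishes.\<close>

definition Z_stat :: "real \<Rightarrow> real \<Rightarrow> nat \<Rightarrow> (nat \<Rightarrow> real) \<Rightarrow> real" where
  "Z_stat d A n x =
     (let D = Max ((\<lambda>i. \<bar>x i\<bar> powr A) ` {1..n})
      in if D = 0 then d else (\<Sum>i=1..n. \<bar>x i\<bar> powr A) / D)"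

end

theory Submission
  imports Defs
begin

text \<open>Put \<open>W\<^sub>i = 1(|H\<^sub>i| > M\<^sub>n) (M\<^sub>n + R\<^sub>i)\<^sup>A\<close> and \<open>p\<^sub>n = P(|H\<^sub>1| > M\<^sub>n)\<close>. As soon as some \<open>W\<^sub>i\<close> is positive,
  \<open>max |X\<^sub>i|\<^sup>A\<close> is a maximum of the \<open>W\<^sub>i\<close>, so \<open>Z\<^sub>n(A) \<ge> \<Sum> W\<^sub>i / (\<Sum> W\<^sub>i\<^sup>2)\<^sup>1\<^sup>/\<^sup>2\<close>. The moments of \<open>M\<^sub>n + R\<^sub>1\<close> of order
  \<open>2A\<close> and \<open>A\<close> are comparable uniformly in \<open>M\<^sub>n\<close>, hence \<open>E W\<^sub>1\<^sup>2 \<le> K (E W\<^sub>1)\<^sup>2 / p\<^sub>n\<close>. Chebyshev's inequality for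
  \<open>\<Sum> W\<^sub>i\<close> and Markov's inequality for \<open>\<Sum> W\<^sub>i\<^sup>2\<close> give \<open>P(Z\<^sub>n(A) \<le> c) \<le> 4 K (1 + c\<^sup>2) / (n p\<^sub>n)\<close>, which for
  \<open>c = x n\<^sup>\<epsilon>\<^sup>/\<^sup>2\<close> is at most a constant times \<open>1 / (n\<^sup>1\<^sup>-\<^sup>\<epsilon> p\<^sub>n)\<close>. So the probability in question even tends to 1.\<close>

section \<open>Comparison of moments of a shifted variable, uniformly in the shift\<close>

text \<open>The power \<open>(m + Y) powr A\<close> is at most \<open>2 powr A\<close> times
  \<open>m powr A + Y powr A\<close>, while its mean dominates both \<open>m powr A\<close> and the
  mean of \<open>Y powr A\<close>. One \<open>K\<close> therefore serves for every shift, as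
  required for a truncation level that varies with the sample size.\<close>

lemma (in prob_space) shifted_moment_comparison:
  fixes Y :: "'a \<Rightarrow> real"
  assumes [measurable]: "Y \<in> borel_measurable M"
    and nonneg: "\<And>\<omega>. 0 \<le> Y \<omega>" and A: "0 < A"
    and int: "integrable M (\<lambda>\<omega>. Y \<omega> powr (2 * A))"
  obtains K where "0 < K"
    "\<And>m. 0 < m \<Longrightarrow> integrable M (\<lambda>\<omega>. (m + Y \<omega>) powr A)"
    "\<And>m. 0 < m \<Longrightarrow> integrable M (\<lambda>\<omega>. ((m + Y \<omega>) powr A)\<^sup>2)"
    "\<And>m. 0 < m \<Longrightarrow> 0 < expectation (\<lambda>\<omega>. (m + Y \<omega>) powr A)"
    "\<And>m. 0 < m \<Longrightarrow> expectation (\<lambda>\<omega>. ((m + Y \<omega>) powr A)\<^sup>2)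
       \<le> K * (expectation (\<lambda>\<omega>. (m + Y \<omega>) powr A))\<^sup>2"
proof -
  define F where "F \<omega> = Y \<omega> powr A" for \<omega>
  have [measurable]: "F \<in> borel_measurable M"
    unfolding F_def by measurable
  have F0: "0 \<le> F \<omega>" for \<omega> by (simp add: F_def)
  have "(F \<omega>)\<^sup>2 = Y \<omega> powr (2 * A)" for \<omega>
    by (simp add: F_def power2_eq_square flip: powr_add)
  then have intF2: "integrable M (\<lambda>\<omega>. (F \<omega>)\<^sup>2)" using int by simp
  have intF: "integrable M F"
    by (rule square_integrable_imp_integrable) (use intF2 in auto)
  define f where "f = expectation F"
  define g where "g = expectation (\<lambda>\<omega>. (F \<omega>)\<^sup>2)"
  have f0: "0 \<le> f" unfolding f_def by (rule Bochner_Integration.integral_nonneg) (simp add: F0)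
  have g0: "0 \<le> g" unfolding g_def by (rule Bochner_Integration.integral_nonneg) simp
  \<comment> \<open>If the mean \<open>f\<close> is 0, then \<open>F\<close> vanishes almost
    everywhere, so \<open>g\<close> is 0 and any \<open>L\<close> works; otherwise the quotient
    serves.\<close>
  obtain L where L: "0 \<le> L" "g \<le> L * f\<^sup>2"
  proof (cases "f = 0")
    case True
    then have "AE \<omega> in M. F \<omega> = 0"
      using integral_nonneg_eq_0_iff_AE[OF intF] F0 by (simp add: f_def)
    then have "g = expectation (\<lambda>\<omega>. 0)"
      unfolding g_def by (intro integral_cong_AE) auto
    then show ?thesis using that[of 0] by simp
  next
    case False
    then show ?thesis using that[of "g / f\<^sup>2"] g0 by simp
  qed
  \<comment> \<open>The factor \<open>1 + L\<close> arises because \<open>(m powr A)\<^sup>2\<close>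
    and \<open>g\<close> are at most 1 and \<open>L\<close> times the squared mean; the rest is the
    constant of \<open>upper2\<close>.\<close>
  define K where "K = 2 * (2 powr A)\<^sup>2 * (1 + L)"
  have K: "0 < K" using L by (simp add: K_def)
  have upper: "(m + Y \<omega>) powr A \<le> 2 powr A * (m powr A + F \<omega>)" if "0 < m" for m \<omega>
  proof -
    have "(m + Y \<omega>) powr A \<le> (2 * max m (Y \<omega>)) powr A"
      using that nonneg A by (intro powr_mono2) auto
    also have "\<dots> = 2 powr A * max m (Y \<omega>) powr A"
      using that nonneg by (simp add: powr_mult)
    also have "max m (Y \<omega>) powr A \<le> m powr A + F \<omega>"
      by (simp add: max_def F_def)
    finally show ?thesis by simp
  qed
  have upper2: "((m + Y \<omega>) powr A)\<^sup>2 \<le> 2 * (2 powr A)\<^sup>2 * ((m powr A)\<^sup>2 + (F \<omega>)\<^sup>2)"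
    if "0 < m" for m \<omega>
  proof -
    have "((m + Y \<omega>) powr A)\<^sup>2 \<le> (2 powr A)\<^sup>2 * (m powr A + F \<omega>)\<^sup>2"
      unfolding power_mult_distrib[symmetric] by (rule power_mono[OF upper[OF that]]) simp
    \<comment> \<open>Equivalent to nonnegativity of the square of
      \<open>m powr A - F \<omega>\<close>.\<close>
    also have "(m powr A + F \<omega>)\<^sup>2 \<le> 2 * ((m powr A)\<^sup>2 + (F \<omega>)\<^sup>2)"
      using sum_squares_ge_zero[of "m powr A - F \<omega>" 0] by (simp add: power2_eq_square algebra_simps)
    finally show ?thesis by (simp add: algebra_simps)
  qed
  have int1: "integrable M (\<lambda>\<omega>. (m + Y \<omega>) powr A)" if "0 < m" for m
    by (rule Bochner_Integration.integrable_bound[of _ "\<lambda>\<omega>. 2 powr A * (m powr A + F \<omega>)"])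
       (use intF upper[OF that] F0 in auto)
  have int2: "integrable M (\<lambda>\<omega>. ((m + Y \<omega>) powr A)\<^sup>2)" if "0 < m" for m
    by (rule Bochner_Integration.integrable_bound[of _ "\<lambda>\<omega>. 2 * (2 powr A)\<^sup>2 * ((m powr A)\<^sup>2 + (F \<omega>)\<^sup>2)"])
       (use intF2 upper2[OF that] in auto)
  have ge_m: "m powr A \<le> expectation (\<lambda>\<omega>. (m + Y \<omega>) powr A)" if "0 < m" for m
  proof -
    have "expectation (\<lambda>\<omega>. m powr A) \<le> expectation (\<lambda>\<omega>. (m + Y \<omega>) powr A)"
      using that nonneg A by (intro integral_mono int1 powr_mono2) auto
    then show ?thesis by (simp add: prob_space)
  qed
  have ge_f: "f \<le> expectation (\<lambda>\<omega>. (m + Y \<omega>) powr A)" if "0 < m" for m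
    unfolding f_def
    using that nonneg A by (intro integral_mono int1 intF) (auto simp: F_def intro!: powr_mono2)
  show thesis
  proof (rule that[OF K int1 int2])
    fix m :: real assume m: "0 < m"
    let ?e = "expectation (\<lambda>\<omega>. (m + Y \<omega>) powr A)"
    show "0 < ?e" using ge_m[OF m] m by (auto intro: less_le_trans[rotated])
    have "expectation (\<lambda>\<omega>. ((m + Y \<omega>) powr A)\<^sup>2)
        \<le> expectation (\<lambda>\<omega>. 2 * (2 powr A)\<^sup>2 * ((m powr A)\<^sup>2 + (F \<omega>)\<^sup>2))"
      using intF2 by (intro integral_mono int2[OF m] upper2[OF m]) auto
    also have "\<dots> = 2 * (2 powr A)\<^sup>2 * ((m powr A)\<^sup>2 + g)"
      using intF2 by (simp add: g_def prob_space)
    also have "(m powr A)\<^sup>2 + g \<le> ?e\<^sup>2 + L * ?e\<^sup>2"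
      using L f0 ge_m[OF m] ge_f[OF m]
      by (intro add_mono power_mono order.trans[OF L(2)] mult_left_mono) auto
    finally show "expectation (\<lambda>\<omega>. ((m + Y \<omega>) powr A)\<^sup>2) \<le> K * ?e\<^sup>2"
      by (simp add: K_def algebra_simps)
  qed auto
qed

section \<open>Chebyshev and Markov bounds for uncorrelated sums\<close>

text \<open>The two thresholds are matched so that on the event the sum exceeds \<open>c\<close>
  times the square root of the sum of squares. Vanishing correlations bound the variance by
  \<open>card I * v\<close>, so Chebyshev costs \<open>4 * v / (card I * m\<^sup>2)\<close>; Markov
  costs \<open>c\<^sup>2\<close> times as much, and a union bound adds the two.\<close>

lemma (in prob_space) prob_uncorrelated_sum_large:
  fixes W :: "'i \<Rightarrow> 'a \<Rightarrow> real" and m v c :: real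
  assumes I: "finite I" "I \<noteq> {}"
    and intW: "\<And>i. i \<in> I \<Longrightarrow> integrable M (W i)"
    and intWW: "\<And>i j. i \<in> I \<Longrightarrow> j \<in> I \<Longrightarrow> integrable M (\<lambda>\<omega>. W i \<omega> * W j \<omega>)"
    and m: "\<And>i. i \<in> I \<Longrightarrow> expectation (W i) = m" "0 < m"
    and v: "\<And>i. i \<in> I \<Longrightarrow> expectation (\<lambda>\<omega>. (W i \<omega>)\<^sup>2) = v"
    and uncorr: "\<And>i j. i \<in> I \<Longrightarrow> j \<in> I \<Longrightarrow> i \<noteq> j \<Longrightarrow> expectation (\<lambda>\<omega>. W i \<omega> * W j \<omega>) = m\<^sup>2"
    and c: "0 < c"
  shows "1 - 4 * (1 + c\<^sup>2) * v / (card I * m\<^sup>2)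
    \<le> prob {\<omega> \<in> space M. card I * m / 2 < (\<Sum>i\<in>I. W i \<omega>) \<and>
          (\<Sum>i\<in>I. (W i \<omega>)\<^sup>2) < (card I * m / (2 * c))\<^sup>2}"
proof -
  define n where "n = real (card I)"
  have n: "0 < n" using I by (simp add: n_def card_gt_0_iff)
  define S where "S \<omega> = (\<Sum>i\<in>I. W i \<omega>)" for \<omega>
  define Q where "Q \<omega> = (\<Sum>i\<in>I. (W i \<omega>)\<^sup>2)" for \<omega>
  have intS: "integrable M S" unfolding S_def using intW by auto
  have intQ: "integrable M Q" unfolding Q_def using intWW by (auto simp: power2_eq_square)
  note [measurable] = borel_measurable_integrable[OF intS] borel_measurable_integrable[OF intQ]
  have S2: "(S \<omega>)\<^sup>2 = (\<Sum>i\<in>I. \<Sum>j\<in>I. W i \<omega> * W j \<omega>)" for \<omega>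
    by (simp add: S_def power2_eq_square sum_product)
  have intS2: "integrable M (\<lambda>\<omega>. (S \<omega>)\<^sup>2)" unfolding S2 using intWW by auto
  have ES: "expectation S = n * m"
    unfolding S_def using intW m by (simp add: n_def)
  have EQ: "expectation Q = n * v"
    unfolding Q_def using intWW v by (simp add: n_def power2_eq_square)
  have v0: "0 \<le> v"
    using I v by (metis (no_types, lifting) Bochner_Integration.integral_nonneg ex_in_conv zero_le_power2)
  have "expectation (\<lambda>\<omega>. (S \<omega>)\<^sup>2) = (\<Sum>i\<in>I. \<Sum>j\<in>I. expectation (\<lambda>\<omega>. W i \<omega> * W j \<omega>))"
    unfolding S2 using intWW by (simp add: Bochner_Integration.integral_sum)
  \<comment> \<open>On the diagonal \<open>v\<close> is enlarged to \<open>m\<^sup>2 + v\<close>;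
    the terms \<open>m\<^sup>2\<close> then fill the whole square and sum to the squared mean, which
    the variance subtracts.\<close>
  also have "\<dots> \<le> (\<Sum>i\<in>I. \<Sum>j\<in>I. m\<^sup>2 + (if i = j then v else 0))"
    using uncorr v by (intro sum_mono) (auto simp: power2_eq_square)
  also have "\<dots> = n * v + (n * m)\<^sup>2"
    using I by (simp add: sum.distrib n_def power2_eq_square algebra_simps)
  finally have ES2: "expectation (\<lambda>\<omega>. (S \<omega>)\<^sup>2) \<le> n * v + (n * m)\<^sup>2" .
  have "prob {\<omega>\<in>space M. n * m / 2 \<le> \<bar>S \<omega> - expectation S\<bar>} \<le> variance S / (n * m / 2)\<^sup>2"
    using n m intS2 by (intro Chebyshev_inequality) auto
  also have "\<dots> \<le> n * v / (n * m / 2)\<^sup>2"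
    using ES2 ES variance_eq[OF intS intS2] by (intro divide_right_mono) auto
  also have "\<dots> = 4 * v / (n * m\<^sup>2)"
    using n m by (simp add: field_simps power2_eq_square)
  finally have P1: "prob {\<omega>\<in>space M. n * m / 2 \<le> \<bar>S \<omega> - expectation S\<bar>} \<le> 4 * v / (n * m\<^sup>2)" .
  have "prob {\<omega>\<in>space M. (n * m / (2 * c))\<^sup>2 \<le> Q \<omega>} \<le> expectation Q / (n * m / (2 * c))\<^sup>2"
  proof (rule integral_Markov_inequality_measure[OF intQ, of "{}"])
    show "AE \<omega> in M. 0 \<le> Q \<omega>" by (simp add: Q_def sum_nonneg)
  qed (use n m c in auto)
  also have "\<dots> = 4 * c\<^sup>2 * v / (n * m\<^sup>2)"
    using n m c by (simp add: EQ field_simps power2_eq_square)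
  finally have P2: "prob {\<omega>\<in>space M. (n * m / (2 * c))\<^sup>2 \<le> Q \<omega>} \<le> 4 * c\<^sup>2 * v / (n * m\<^sup>2)" .
  define G where "G = {\<omega>\<in>space M. n * m / 2 < S \<omega> \<and> Q \<omega> < (n * m / (2 * c))\<^sup>2}"
  have [measurable]: "G \<in> events" unfolding G_def by measurable
  have "1 - prob G = prob (space M - G)" by (simp add: prob_compl)
  \<comment> \<open>Since the mean of \<open>S\<close> is \<open>n * m\<close>, a value of at most
    half of it is a deviation of at least \<open>n * m / 2\<close>.\<close>
  also have "\<dots> \<le> prob ({\<omega>\<in>space M. n * m / 2 \<le> \<bar>S \<omega> - expectation S\<bar>}
      \<union> {\<omega>\<in>space M. (n * m / (2 * c))\<^sup>2 \<le> Q \<omega>})"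
    by (intro finite_measure_mono) (auto simp: G_def ES field_simps abs_if)
  also have "\<dots> \<le> prob {\<omega>\<in>space M. n * m / 2 \<le> \<bar>S \<omega> - expectation S\<bar>}
      + prob {\<omega>\<in>space M. (n * m / (2 * c))\<^sup>2 \<le> Q \<omega>}"
    by (intro measure_Un_le) measurable
  also have "\<dots> \<le> 4 * v / (n * m\<^sup>2) + 4 * c\<^sup>2 * v / (n * m\<^sup>2)"
    using P1 P2 by simp
  also have "\<dots> = 4 * (1 + c\<^sup>2) * v / (n * m\<^sup>2)"
    by (simp add: field_simps flip: add_divide_distrib)
  finally show ?thesis by (simp add: G_def n_def S_def Q_def)
qed

section \<open>Pathwise lower bound for the statistic\<close>

text \<open>The maximum of the sample is attained at an index with \<open>\<bar>h i\<bar> > m\<close>, and is at most the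
  \<open>\<ell>\<^sup>2\<close> norm of \<open>w\<close>.\<close>

lemma Z_stat_truncate_tail_ge:
  fixes h r x w :: "nat \<Rightarrow> real"
  assumes m: "0 < m" and A: "0 < A"
    and r: "\<And>i. i \<in> {1..n} \<Longrightarrow> 0 \<le> r i"
    and x: "\<And>i. i \<in> {1..n} \<Longrightarrow> x i = truncate_tail m (h i) (r i)"
    and w: "\<And>i. i \<in> {1..n} \<Longrightarrow> w i = of_bool (m < \<bar>h i\<bar>) * (m + r i) powr A"
    and pos: "0 < (\<Sum>i=1..n. w i)" and t: "0 < t" and sq: "(\<Sum>i=1..n. (w i)\<^sup>2) \<le> t\<^sup>2"
  shows "(\<Sum>i=1..n. w i) / t \<le> Z_stat d A n x"
proof -
  have w0: "0 \<le> w i" if "i \<in> {1..n}" for i using that w by simp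
  have wt: "w i \<le> t" if "i \<in> {1..n}" for i
  proof -
    have "(w i)\<^sup>2 \<le> (\<Sum>i=1..n. (w i)\<^sup>2)" by (rule member_le_sum) (use that in auto)
    then have "(w i)\<^sup>2 \<le> t\<^sup>2" using sq by (rule order.trans)
    then show ?thesis by (rule power2_le_imp_le) (use t in simp)
  qed
  obtain j where j: "j \<in> {1..n}" "0 < w j"
    using pos sum_nonpos[of "{1..n}" w] by (metis leD not_le_imp_less)
  have hj: "m < \<bar>h j\<bar>" using j w[of j] by (auto simp: of_bool_def split: if_splits)
  have big: "\<bar>x i\<bar> powr A = w i" if "i \<in> {1..n}" "m < \<bar>h i\<bar>" for i
    using that m r[of i] by (simp add: x w truncate_tail_def abs_mult)
  have small: "\<bar>x i\<bar> powr A \<le> m powr A" if "i \<in> {1..n}" "\<not> m < \<bar>h i\<bar>" for i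
    using that A by (intro powr_mono2) (auto simp: x truncate_tail_def)
  \<comment> \<open>The index \<open>j\<close> carries the bound \<open>t\<close> over to the other
    terms: \<open>w j\<close> dominates \<open>m powr A\<close>, hence every term with
    \<open>\<bar>h i\<bar> \<le> m\<close>.\<close>
  have "m powr A \<le> w j"
    using hj j m A r[of j] by (simp add: w powr_mono2)
  then have xt: "\<bar>x i\<bar> powr A \<le> t" if "i \<in> {1..n}" for i
    using that big[of i] small[of i] wt[of i] wt[of j] j by (cases "m < \<bar>h i\<bar>") auto
  define D where "D = Max ((\<lambda>i. \<bar>x i\<bar> powr A) ` {1..n})"
  \<comment> \<open>A positive maximum excludes the default value \<open>d\<close> of
    \<open>Z_stat\<close>.\<close>
  have "\<bar>x j\<bar> powr A \<le> D" unfolding D_def using j by (intro Max_ge) auto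
  then have D0: "0 < D" using j hj big[of j] by simp
  have Dt: "D \<le> t" unfolding D_def using j xt by (subst Max_le_iff) auto
  have "(\<Sum>i=1..n. w i) \<le> (\<Sum>i=1..n. \<bar>x i\<bar> powr A)"
  proof (rule sum_mono)
    fix i assume "i \<in> {1..n}"
    then show "w i \<le> \<bar>x i\<bar> powr A" using big[of i] w[of i] by (cases "m < \<bar>h i\<bar>") auto
  qed
  then have "(\<Sum>i=1..n. w i) / t \<le> (\<Sum>i=1..n. \<bar>x i\<bar> powr A) / D"
    using pos D0 Dt by (intro frac_le) auto
  then show ?thesis using D0 by (simp add: Z_stat_def D_def Let_def)
qed

section \<open>Moments of products taken from two independent families\<close>

text \<open>These facts make the products \<open>f (H i) * g (R i)\<close> uncorrelated.
  Independence of the two whole families descends to functions of one or two coordinates; a product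
  of two such terms regroups as an \<open>H\<close> part times an \<open>R\<close> part, which
  factors first across the families and then inside each.\<close>

lemma (in prob_space)
  fixes H R :: "'i \<Rightarrow> 'a \<Rightarrow> real" and f g :: "real \<Rightarrow> real"
  assumes H: "indep_vars (\<lambda>_. borel) H I" and R: "indep_vars (\<lambda>_. borel) R I"
    and HR: "indep_var (PiM I (\<lambda>_. borel)) (\<lambda>\<omega>. \<lambda>j\<in>I. H j \<omega>) (PiM I (\<lambda>_. borel)) (\<lambda>\<omega>. \<lambda>j\<in>I. R j \<omega>)"
    and [measurable]: "f \<in> borel_measurable borel" "g \<in> borel_measurable borel"
    and intf: "\<And>i. i \<in> I \<Longrightarrow> integrable M (\<lambda>\<omega>. f (H i \<omega>))"
    and intg: "\<And>i. i \<in> I \<Longrightarrow> integrable M (\<lambda>\<omega>. g (R i \<omega>))"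
  shows indep_families_integrable:
      "i \<in> I \<Longrightarrow> integrable M (\<lambda>\<omega>. f (H i \<omega>) * g (R i \<omega>))"
    and indep_families_expectation:
      "i \<in> I \<Longrightarrow> expectation (\<lambda>\<omega>. f (H i \<omega>) * g (R i \<omega>))
         = expectation (\<lambda>\<omega>. f (H i \<omega>)) * expectation (\<lambda>\<omega>. g (R i \<omega>))"
    and indep_families_integrable_mult:
      "i \<in> I \<Longrightarrow> j \<in> I \<Longrightarrow> i \<noteq> j \<Longrightarrow>
         integrable M (\<lambda>\<omega>. (f (H i \<omega>) * g (R i \<omega>)) * (f (H j \<omega>) * g (R j \<omega>)))"
    and indep_families_expectation_mult:
      "i \<in> I \<Longrightarrow> j \<in> I \<Longrightarrow> i \<noteq> j \<Longrightarrow>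
         expectation (\<lambda>\<omega>. (f (H i \<omega>) * g (R i \<omega>)) * (f (H j \<omega>) * g (R j \<omega>)))
         = (expectation (\<lambda>\<omega>. f (H i \<omega>)) * expectation (\<lambda>\<omega>. g (R i \<omega>))) *
           (expectation (\<lambda>\<omega>. f (H j \<omega>)) * expectation (\<lambda>\<omega>. g (R j \<omega>)))"
proof -
  have single: "indep_var borel (\<lambda>\<omega>. f (H i \<omega>)) borel (\<lambda>\<omega>. g (R i \<omega>))" if "i \<in> I" for i
  proof -
    have "indep_var borel ((\<lambda>y. f (y i)) \<circ> (\<lambda>\<omega>. \<lambda>j\<in>I. H j \<omega>)) borel ((\<lambda>y. g (y i)) \<circ> (\<lambda>\<omega>. \<lambda>j\<in>I. R j \<omega>))"
      using that by (intro indep_var_compose[OF HR]) measurable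
    then show ?thesis using that by (simp add: comp_def)
  qed
  show "i \<in> I \<Longrightarrow> integrable M (\<lambda>\<omega>. f (H i \<omega>) * g (R i \<omega>))"
    "i \<in> I \<Longrightarrow> expectation (\<lambda>\<omega>. f (H i \<omega>) * g (R i \<omega>))
         = expectation (\<lambda>\<omega>. f (H i \<omega>)) * expectation (\<lambda>\<omega>. g (R i \<omega>))"
    using indep_var_integrable[OF single intf intg] indep_var_lebesgue_integral[OF single intf intg] by auto
  assume ij: "i \<in> I" "j \<in> I" "i \<noteq> j"
  \<comment> \<open>Distinct indices form disjoint singleton blocks of one independent
    family.\<close>
  have within: "indep_var borel (\<lambda>\<omega>. \<phi> (Y i \<omega>)) borel (\<lambda>\<omega>. \<phi> (Y j \<omega>))"
    if Y: "indep_vars (\<lambda>_. borel) Y I" and [measurable]: "\<phi> \<in> borel_measurable borel"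
    for Y :: "'i \<Rightarrow> 'a \<Rightarrow> real" and \<phi> :: "real \<Rightarrow> real"
  proof -
    have "indep_var borel ((\<lambda>y. \<phi> (y i)) \<circ> (\<lambda>\<omega>. restrict (\<lambda>i. Y i \<omega>) {i}))
        borel ((\<lambda>y. \<phi> (y j)) \<circ> (\<lambda>\<omega>. restrict (\<lambda>i. Y i \<omega>) {j}))"
      using ij by (intro indep_var_compose[OF indep_var_restrict[OF Y]]) auto
    then show ?thesis by (simp add: comp_def)
  qed
  have "indep_var borel ((\<lambda>y. f (y i) * f (y j)) \<circ> (\<lambda>\<omega>. \<lambda>j\<in>I. H j \<omega>))
      borel ((\<lambda>y. g (y i) * g (y j)) \<circ> (\<lambda>\<omega>. \<lambda>j\<in>I. R j \<omega>))"
    using ij by (intro indep_var_compose[OF HR]) measurable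
  then have pair: "indep_var borel (\<lambda>\<omega>. f (H i \<omega>) * f (H j \<omega>)) borel (\<lambda>\<omega>. g (R i \<omega>) * g (R j \<omega>))"
    using ij by (simp add: comp_def)
  have F: "integrable M (\<lambda>\<omega>. f (H i \<omega>) * f (H j \<omega>))"
      "expectation (\<lambda>\<omega>. f (H i \<omega>) * f (H j \<omega>)) = expectation (\<lambda>\<omega>. f (H i \<omega>)) * expectation (\<lambda>\<omega>. f (H j \<omega>))"
    using indep_var_integrable[OF within[OF H] intf intf] indep_var_lebesgue_integral[OF within[OF H] intf intf] ij
    by auto
  have G: "integrable M (\<lambda>\<omega>. g (R i \<omega>) * g (R j \<omega>))"
      "expectation (\<lambda>\<omega>. g (R i \<omega>) * g (R j \<omega>)) = expectation (\<lambda>\<omega>. g (R i \<omega>)) * expectation (\<lambda>\<omega>. g (R j \<omega>))"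
    using indep_var_integrable[OF within[OF R] intg intg] indep_var_lebesgue_integral[OF within[OF R] intg intg] ij
    by auto
  have eq: "(\<lambda>\<omega>. (f (H i \<omega>) * g (R i \<omega>)) * (f (H j \<omega>) * g (R j \<omega>)))
      = (\<lambda>\<omega>. (f (H i \<omega>) * f (H j \<omega>)) * (g (R i \<omega>) * g (R j \<omega>)))"
    by (simp add: mult_ac)
  show "integrable M (\<lambda>\<omega>. (f (H i \<omega>) * g (R i \<omega>)) * (f (H j \<omega>) * g (R j \<omega>)))"
    unfolding eq by (rule indep_var_integrable[OF pair F(1) G(1)])
  show "expectation (\<lambda>\<omega>. (f (H i \<omega>) * g (R i \<omega>)) * (f (H j \<omega>) * g (R j \<omega>)))
         = (expectation (\<lambda>\<omega>. f (H i \<omega>)) * expectation (\<lambda>\<omega>. g (R i \<omega>))) *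
           (expectation (\<lambda>\<omega>. f (H j \<omega>)) * expectation (\<lambda>\<omega>. g (R j \<omega>)))"
    unfolding eq indep_var_lebesgue_integral[OF pair F(1) G(1)] F(2) G(2) by (simp add: mult_ac)
qed

section \<open>Lower bound for the tail probabilities of the normalized statistic\<close>

theorem proposition4p4:
  fixes P :: "'a measure"
    and H R :: "nat \<Rightarrow> 'a \<Rightarrow> real"
    and X :: "nat \<Rightarrow> nat \<Rightarrow> 'a \<Rightarrow> real"
    and M :: "nat \<Rightarrow> real"
    and d :: "nat \<Rightarrow> 'a \<Rightarrow> real"
    and Z :: "nat \<Rightarrow> 'a \<Rightarrow> real"
    and \<alpha> A \<epsilon> :: real
  assumes "prob_space P"
    and "\<alpha> > 0"
    and "prob_space.indep_vars P (\<lambda>_. borel) H {1..}"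
    and "\<forall>j\<ge>1. distr P borel (H j) = distr P borel (H 1)"
    and "regularly_varying_tails (distr P borel (H 1)) \<alpha>"
    and "prob_space.indep_vars P (\<lambda>_. borel) R {1..}"
    and "\<forall>j\<ge>1. distr P borel (R j) = distr P borel (R 1)"
    and "\<forall>j\<ge>1. AE \<omega> in P. R j \<omega> \<ge> 0"
    and "prob_space.indep_var P
           (PiM {1..} (\<lambda>_. borel)) (\<lambda>\<omega>. \<lambda>j\<in>{1..}. H j \<omega>)
           (PiM {1..} (\<lambda>_. borel)) (\<lambda>\<omega>. \<lambda>j\<in>{1..}. R j \<omega>)"
    and "\<forall>n\<ge>1. M n > 0"
    and "\<forall>n\<ge>1. \<forall>j\<in>{1..n}. \<forall>\<omega>\<in>space P. X n j \<omega> = truncate_tail (M n) (H j \<omega>) (R j \<omega>)"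
    and "\<alpha> < A"
    and "\<forall>n. d n \<in> borel_measurable P"
    and "\<forall>n\<ge>1. \<forall>\<omega>\<in>space P. Z n \<omega> = Z_stat (d n \<omega>) A n (\<lambda>i. X n i \<omega>)"
    and "0 < \<epsilon>" and "\<epsilon> < 1"
    and "integrable P (\<lambda>\<omega>. R 1 \<omega> powr (2 * A))"
    and "filterlim (\<lambda>n. real n powr (1 - \<epsilon>) * measure P {\<omega>\<in>space P. \<bar>H 1 \<omega>\<bar> > M n})
           at_top sequentially"
  shows "\<forall>x>0. liminf (\<lambda>n. ereal (measure P {\<omega>\<in>space P. real n powr (- \<epsilon> / 2) * Z n \<omega> > x}))
           \<ge> ereal (exp (- x\<^sup>2))"
proof -
  interpret prob_space P by fact
  note H = assms(3) and H_id = assms(4) and R = assms(6) and R_id = assms(7) and R_nonneg = assms(8)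
    and HR = assms(9) and M_pos = assms(10) and X = assms(11) and Z = assms(14)
    and hard = assms(18)
  have A: "0 < A" using assms(2,12) by simp
  have H_meas[measurable]: "H i \<in> borel_measurable P" and R_meas[measurable]: "R i \<in> borel_measurable P" if "i \<in> {1..}" for i
    using H R that by (auto simp: indep_vars_def)
  have [measurable]: "d n \<in> borel_measurable P" for n using assms(13) by simp
  \<comment> \<open>Equality of laws moves every moment computation to index 1.\<close>
  have transfer: "expectation (\<lambda>\<omega>. \<phi> (Y i \<omega>)) = expectation (\<lambda>\<omega>. \<phi> (Y 1 \<omega>))"
      "integrable P (\<lambda>\<omega>. \<phi> (Y i \<omega>)) \<longleftrightarrow> integrable P (\<lambda>\<omega>. \<phi> (Y 1 \<omega>))"
    if i: "i \<in> {1..}" and Y_id: "\<forall>j\<ge>1. distr P borel (Y j) = distr P borel (Y 1)"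
      and Y: "\<And>i. i \<in> {1..} \<Longrightarrow> Y i \<in> borel_measurable P" and \<phi>: "\<phi> \<in> borel_measurable borel"
    for i and Y :: "nat \<Rightarrow> 'a \<Rightarrow> real" and \<phi> :: "real \<Rightarrow> real"
  proof -
    have 1: "(1::nat) \<in> {1..}" by simp
    have D: "distr P borel (Y i) = distr P borel (Y 1)" using Y_id i by blast
    show "expectation (\<lambda>\<omega>. \<phi> (Y i \<omega>)) = expectation (\<lambda>\<omega>. \<phi> (Y 1 \<omega>))"
      unfolding integral_distr[OF Y[OF i] \<phi>, symmetric] integral_distr[OF Y[OF 1] \<phi>, symmetric] D ..
    show "integrable P (\<lambda>\<omega>. \<phi> (Y i \<omega>)) \<longleftrightarrow> integrable P (\<lambda>\<omega>. \<phi> (Y 1 \<omega>))"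
      unfolding integrable_distr_eq[OF Y[OF i] \<phi>, symmetric] integrable_distr_eq[OF Y[OF 1] \<phi>, symmetric] D ..
  qed
  note H_eq = transfer(1)[OF _ H_id H_meas]
    and R_eq = transfer(1)[OF _ R_id R_meas]
    and R_int = transfer(2)[OF _ R_id R_meas]
  \<comment> \<open>The moment comparison asks for nonnegativity at every point, whereas
    \<open>R 1\<close> is nonnegative only almost everywhere; its absolute value agrees with it
    almost everywhere.\<close>
  have "integrable P (\<lambda>\<omega>. \<bar>R 1 \<omega>\<bar> powr (2 * A)) \<longleftrightarrow> integrable P (\<lambda>\<omega>. R 1 \<omega> powr (2 * A))"
    using R_nonneg by (intro integrable_cong_AE) (auto elim!: eventually_mono)
  then have int_abs: "integrable P (\<lambda>\<omega>. \<bar>R 1 \<omega>\<bar> powr (2 * A))" using assms(17) by simp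
  obtain K where K: "0 < K"
    "\<And>m. 0 < m \<Longrightarrow> integrable P (\<lambda>\<omega>. (m + \<bar>R 1 \<omega>\<bar>) powr A)"
    "\<And>m. 0 < m \<Longrightarrow> integrable P (\<lambda>\<omega>. ((m + \<bar>R 1 \<omega>\<bar>) powr A)\<^sup>2)"
    "\<And>m. 0 < m \<Longrightarrow> 0 < expectation (\<lambda>\<omega>. (m + \<bar>R 1 \<omega>\<bar>) powr A)"
    "\<And>m. 0 < m \<Longrightarrow> expectation (\<lambda>\<omega>. ((m + \<bar>R 1 \<omega>\<bar>) powr A)\<^sup>2)
       \<le> K * (expectation (\<lambda>\<omega>. (m + \<bar>R 1 \<omega>\<bar>) powr A))\<^sup>2"
    by (rule shifted_moment_comparison[OF _ _ A int_abs]) auto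
  define p where "p n = prob {\<omega>\<in>space P. \<bar>H 1 \<omega>\<bar> > M n}" for n

  \<comment> \<open>Finite-sample bound for the probability that the statistic exceeds a
    level\<close>
  have Z_lower: "1 - 4 * K * (1 + c\<^sup>2) / (n * p n) \<le> prob {\<omega>\<in>space P. c < Z n \<omega>}"
    if n: "1 \<le> n" and p: "0 < p n" and c: "0 < c" for n c
  proof -
    have m: "0 < M n" using M_pos n by simp
    define f where "f h = (of_bool (M n < \<bar>h\<bar>) :: real)" for h :: real
    define g where "g r = (M n + \<bar>r\<bar>) powr A" for r
    define W where "W i \<omega> = f (H i \<omega>) * g (R i \<omega>)" for i \<omega>
    have [measurable]: "f \<in> borel_measurable borel" "g \<in> borel_measurable borel"
      unfolding f_def g_def by measurable
    \<comment> \<open>Idempotence of the indicator leaves a single factor \<open>p n\<close> in the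
      second moment of \<open>W i\<close>, so the final error is of order
      \<open>1 / (n * p n)\<close>.\<close>
    have f_sq: "(f h)\<^sup>2 = f h" for h by (simp add: f_def)
    have intf: "integrable P (\<lambda>\<omega>. f (H i \<omega>))" if "i \<in> {1..}" for i
      using that by (intro integrable_const_bound[of _ 1]) (auto simp: f_def)
    have intg: "integrable P (\<lambda>\<omega>. g (R i \<omega>))" if "i \<in> {1..}" for i
      using K(2)[OF m] R_int[OF that, of g] by (simp add: g_def)
    have intg2: "integrable P (\<lambda>\<omega>. (g (R i \<omega>))\<^sup>2)" if "i \<in> {1..}" for i
      using K(3)[OF m] R_int[OF that, of "\<lambda>r. (g r)\<^sup>2"] by (simp add: g_def)
    define e where "e = expectation (\<lambda>\<omega>. g (R 1 \<omega>))"
    define e2 where "e2 = expectation (\<lambda>\<omega>. (g (R 1 \<omega>))\<^sup>2)"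
    have e: "0 < e" and e2: "e2 \<le> K * e\<^sup>2"
      using K(4,5)[OF m] by (simp_all add: e_def e2_def g_def)
    have "expectation (\<lambda>\<omega>. f (H 1 \<omega>)) = expectation (indicator {\<omega>\<in>space P. M n < \<bar>H 1 \<omega>\<bar>})"
      by (intro Bochner_Integration.integral_cong) (auto simp: f_def)
    also have "\<dots> = p n" by (auto simp: p_def intro!: arg_cong[where f=prob])
    finally have Ef: "expectation (\<lambda>\<omega>. f (H i \<omega>)) = p n" if "i \<in> {1..}" for i
      using H_eq[OF that, of f] by simp
    have Eg: "expectation (\<lambda>\<omega>. g (R i \<omega>)) = e" "expectation (\<lambda>\<omega>. (g (R i \<omega>))\<^sup>2) = e2"
      if "i \<in> {1..}" for i
      using R_eq[OF that, of g] R_eq[OF that, of "\<lambda>r. (g r)\<^sup>2"] by (simp_all add: e_def e2_def)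
    note fam = H R HR \<open>f \<in> _\<close> \<open>g \<in> _\<close> intf intg
    have W_sq: "(W i \<omega>)\<^sup>2 = f (H i \<omega>) * (g (R i \<omega>))\<^sup>2" for i \<omega>
      by (simp add: W_def power_mult_distrib f_sq)
    \<comment> \<open>The product formulas are applied with \<open>\<lambda>r. (g r)\<^sup>2\<close>
      in place of \<open>g\<close>.\<close>
    have sq: "integrable P (\<lambda>\<omega>. (W i \<omega>)\<^sup>2)" "expectation (\<lambda>\<omega>. (W i \<omega>)\<^sup>2) = p n * e2"
      if "i \<in> {1..}" for i
      using indep_families_integrable[OF H R HR _ _ intf intg2 that]
        indep_families_expectation[OF H R HR _ _ intf intg2 that] Ef[OF that] Eg[OF that]
      by (simp_all add: W_sq)
    have "1 - 4 * (1 + c\<^sup>2) * (p n * e2) / (card {1..n} * (p n * e)\<^sup>2)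
      \<le> prob {\<omega> \<in> space P. card {1..n} * (p n * e) / 2 < (\<Sum>i=1..n. W i \<omega>) \<and>
          (\<Sum>i=1..n. (W i \<omega>)\<^sup>2) < (card {1..n} * (p n * e) / (2 * c))\<^sup>2}"
    proof (rule prob_uncorrelated_sum_large)
      show "integrable P (\<lambda>\<omega>. W i \<omega> * W j \<omega>)" if "i \<in> {1..n}" "j \<in> {1..n}" for i j
        using that sq(1)[of i] indep_families_integrable_mult[OF fam, of i j]
        by (cases "i = j") (auto simp: W_def power2_eq_square)
      show "expectation (\<lambda>\<omega>. W i \<omega> * W j \<omega>) = (p n * e)\<^sup>2"
        if "i \<in> {1..n}" "j \<in> {1..n}" "i \<noteq> j" for i j
        using that indep_families_expectation_mult[OF fam, of i j] Ef Eg(1)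
        by (simp add: W_def power2_eq_square)
      show "integrable P (W i)" if "i \<in> {1..n}" for i
        using that indep_families_integrable[OF fam, of i] by (simp add: W_def[abs_def])
      show "expectation (W i) = p n * e" if "i \<in> {1..n}" for i
        using that indep_families_expectation[OF fam, of i] Ef Eg(1) by (simp add: W_def[abs_def])
    qed (use n p e c sq in auto)
    also have "\<dots> \<le> prob {\<omega>\<in>space P. c < Z n \<omega>}"
    \<comment> \<open>The inclusion of events holds only almost surely, where all \<open>R i\<close>
      with \<open>i \<le> n\<close> are nonnegative and \<open>g\<close> gives the true truncated
      value.\<close>
    proof (rule finite_measure_mono_AE)
      have "AE \<omega> in P. \<forall>i\<in>{1..n}. 0 \<le> R i \<omega>"
        using R_nonneg by (intro AE_finite_allI) auto
      then show "AE \<omega> in P. \<omega> \<in> {\<omega> \<in> space P. card {1..n} * (p n * e) / 2 < (\<Sum>i=1..n. W i \<omega>) \<and>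
          (\<Sum>i=1..n. (W i \<omega>)\<^sup>2) < (card {1..n} * (p n * e) / (2 * c))\<^sup>2}
          \<longrightarrow> \<omega> \<in> {\<omega>\<in>space P. c < Z n \<omega>}"
      proof (eventually_elim, intro impI)
        fix \<omega> assume r: "\<forall>i\<in>{1..n}. 0 \<le> R i \<omega>"
          and *: "\<omega> \<in> {\<omega> \<in> space P. card {1..n} * (p n * e) / 2 < (\<Sum>i=1..n. W i \<omega>) \<and>
          (\<Sum>i=1..n. (W i \<omega>)\<^sup>2) < (card {1..n} * (p n * e) / (2 * c))\<^sup>2}"
        \<comment> \<open>Half the mean of the sum is \<open>c * t\<close>, and the sum of squares
          is below \<open>t\<^sup>2\<close>, so the ratio bound yields exactly
          \<open>c\<close>.\<close>
        define t where "t = n * (p n * e) / (2 * c)"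
        have t: "0 < t" using n p e c by (simp add: t_def)
        have S: "c * t < (\<Sum>i=1..n. W i \<omega>)" using * c by (simp add: t_def)
        have "c < (\<Sum>i=1..n. W i \<omega>) / t" using S t by (simp add: field_simps)
        also have "\<dots> \<le> Z_stat (d n \<omega>) A n (\<lambda>i. X n i \<omega>)"
        proof (rule Z_stat_truncate_tail_ge[OF m A])
          show "0 < (\<Sum>i=1..n. W i \<omega>)" using S c t by (meson less_trans mult_pos_pos)
          show "(\<Sum>i=1..n. (W i \<omega>)\<^sup>2) \<le> t\<^sup>2" using * by (simp add: t_def)
          show "X n i \<omega> = truncate_tail (M n) (H i \<omega>) (R i \<omega>)" if "i \<in> {1..n}" for i
            using X n that * by auto
        qed (use r t in \<open>auto simp: W_def f_def g_def\<close>)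
        also have "\<dots> = Z n \<omega>" using Z n * by simp
        finally show "\<omega> \<in> {\<omega>\<in>space P. c < Z n \<omega>}" using * by simp
      qed
      \<comment> \<open>\<open>X\<close> and \<open>Z\<close> are prescribed pointwise on the sample
        space, so their measurability is read off from the defining formulas.\<close>
      have X_meas: "X n i \<in> borel_measurable P" if i: "i \<in> {1..n}" for i
      proof -
        have [measurable]: "H i \<in> borel_measurable P" "R i \<in> borel_measurable P"
          using i H_meas[of i] R_meas[of i] by auto
        have "(\<lambda>\<omega>. truncate_tail (M n) (H i \<omega>) (R i \<omega>)) \<in> borel_measurable P"
          unfolding truncate_tail_def of_bool_def by measurable
        also have "?this \<longleftrightarrow> ?thesis"
          by (rule measurable_cong) (simp only: X[rule_format, OF n i])
        finally show ?thesis .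
      qed
      have "(\<lambda>\<omega>. Z_stat (d n \<omega>) A n (\<lambda>i. X n i \<omega>)) \<in> borel_measurable P"
      proof -
        have [measurable]: "(\<lambda>\<omega>. \<bar>X n i \<omega>\<bar> powr A) \<in> borel_measurable P" if "i \<in> {1..n}" for i
          using X_meas[OF that] by measurable
        have [measurable]: "(\<lambda>\<omega>. Max ((\<lambda>i. \<bar>X n i \<omega>\<bar> powr A) ` {1..n})) \<in> borel_measurable P"
            "(\<lambda>\<omega>. \<Sum>i=1..n. \<bar>X n i \<omega>\<bar> powr A) \<in> borel_measurable P"
          by measurable
        show ?thesis unfolding Z_stat_def Let_def by measurable
      qed
      also have "?this \<longleftrightarrow> Z n \<in> borel_measurable P"
        by (rule measurable_cong) (simp only: Z[rule_format, OF n])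
      finally have [measurable]: "Z n \<in> borel_measurable P" .
      show "{\<omega>\<in>space P. c < Z n \<omega>} \<in> events" by measurable
    qed
    finally have "1 - 4 * (1 + c\<^sup>2) * (p n * e2) / (n * (p n * e)\<^sup>2) \<le> prob {\<omega>\<in>space P. c < Z n \<omega>}"
      by simp
    \<comment> \<open>The moment comparison lets \<open>e\<close> cancel, which removes all
      dependence on the truncation level except through \<open>p n\<close>.\<close>
    moreover have "4 * (1 + c\<^sup>2) * (p n * e2) / (n * (p n * e)\<^sup>2)
        \<le> 4 * (1 + c\<^sup>2) * (p n * (K * e\<^sup>2)) / (n * (p n * e)\<^sup>2)"
      using e2 p by (intro divide_right_mono mult_left_mono) auto
    moreover have "\<dots> = 4 * K * (1 + c\<^sup>2) / (n * p n)"
      using n p e by (simp add: field_simps power2_eq_square)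
    ultimately show ?thesis by linarith
  qed

  \<comment> \<open>Passage to the limit\<close>
  show ?thesis
  proof (intro allI impI)
    fix x :: real assume x: "0 < x"
    define q where "q n = real n powr (1 - \<epsilon>) * p n" for n
    have q: "filterlim q at_top sequentially" using hard by (simp add: q_def[abs_def] p_def[abs_def])
    define L where "L n = 1 - 4 * K * (1 + x\<^sup>2) / q n" for n
    have "L \<longlonglongrightarrow> 1 - 0"
      unfolding L_def
      by (intro tendsto_intros tendsto_divide_0[OF tendsto_const] filterlim_at_top_imp_at_infinity q)
    then have L: "(\<lambda>n. ereal (L n)) \<longlonglongrightarrow> ereal 1" by simp
    \<comment> \<open>Eventually \<open>q n\<close> is positive, and this forces \<open>p n\<close>
      to be positive as \<open>Z_lower\<close> requires.\<close>
    have "\<forall>\<^sub>F n in sequentially. ereal (L n)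
        \<le> ereal (measure P {\<omega>\<in>space P. real n powr (- \<epsilon> / 2) * Z n \<omega> > x})"
      using eventually_ge_at_top[of 1] eventually_gt_at_top[of 0, THEN filterlim_iff[THEN iffD1, OF q, rule_format]]
    proof eventually_elim
      case (elim n)
      have n: "0 < real n" "1 \<le> real n" using elim by auto
      have p: "0 < p n" using elim n by (simp add: q_def zero_less_mult_iff)
      define c where "c = x * real n powr (\<epsilon> / 2)"
      have c: "0 < c" using x n by (simp add: c_def)
      have c2: "c\<^sup>2 = x\<^sup>2 * real n powr \<epsilon>"
        by (simp add: c_def power_mult_distrib power2_eq_square flip: powr_add)
      have n_split: "real n * p n = real n powr \<epsilon> * q n"
        using n by (simp add: q_def flip: powr_add mult.assoc)
      have n_eps: "1 \<le> real n powr \<epsilon>" using n assms(15) by (simp add: ge_one_powr_ge_zero)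
      \<comment> \<open>As \<open>real n powr \<epsilon>\<close> is at least 1, it can be factored
        out of \<open>1 + c\<^sup>2\<close>; it then cancels against the same power in
        \<open>n_split\<close>.\<close>
      have "4 * K * (1 + c\<^sup>2) / (n * p n) \<le> 4 * K * ((1 + x\<^sup>2) * real n powr \<epsilon>) / (n * p n)"
        using n_eps K(1) p n by (intro divide_right_mono mult_left_mono) (auto simp: c2 algebra_simps)
      also have "\<dots> = 4 * K * (1 + x\<^sup>2) / q n"
        using n elim by (simp add: n_split)
      finally have "L n \<le> 1 - 4 * K * (1 + c\<^sup>2) / (n * p n)" by (simp add: L_def)
      also have "\<dots> \<le> prob {\<omega>\<in>space P. c < Z n \<omega>}" using elim p c by (intro Z_lower) auto
      also have "{\<omega>\<in>space P. c < Z n \<omega>} = {\<omega>\<in>space P. real n powr (- \<epsilon> / 2) * Z n \<omega> > x}"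
        using n by (auto simp: c_def powr_minus field_simps)
      finally show ?case by simp
    qed
    then have "liminf (\<lambda>n. ereal (L n))
        \<le> liminf (\<lambda>n. ereal (measure P {\<omega>\<in>space P. real n powr (- \<epsilon> / 2) * Z n \<omega> > x}))"
      by (rule Liminf_mono)
    also have "liminf (\<lambda>n. ereal (L n)) = ereal 1" by (rule lim_imp_Liminf[OF _ L]) simp
    \<comment> \<open>The limit inferior is at least 1, and the exponential is at most 1.\<close>
    finally show "ereal (exp (- x\<^sup>2))
        \<le> liminf (\<lambda>n. ereal (measure P {\<omega>\<in>space P. real n powr (- \<epsilon> / 2) * Z n \<omega> > x}))"
      by (rule order.trans[rotated]) simp
  qed
qed

end
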